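(* Let $\Omega=\mathbb{R}^3\setminus B_1(0)$. Let $\varphi\in L^\infty(\Omega)$ be radially symmetric with $\sup_{\rho\ge1}|\rho\varphi(\rho)|<\infty$. Assume further that $\varphi_b$ is constant, $\varepsilon_0\in(0,1/\sqrt{\pi})$ and $0<\tau_1<\tau_2<\infty$. For $\varepsilon\in(0,\varepsilon_0)$ let $u_\varepsilon=v_\varepsilon+w_\varepsilon$ be the radially symmetric global-in-time solution described in the context. Then there is $C>0$ such that $$\sup_{\tau_1<t<\tau_2}\|u_\varepsilon(\cdot,t)-S_2(t)\varphi_b\|_{L^\infty(\Omega)}\le C\sqrt{\varepsilon}\qquad\text{for every }\varepsilon\in(0,\varepsilon_0).$$
   Context: Setting: $B_1(0)=\{x\in\mathbb{R}^3: |x|<1\}$, $\Omega=\mathbb{R}^3\setminus B_1(0)$. All functions are radially symmetric in $x$ and written as functions of $r=|x|$; a radially symmetric element of $L^\infty(\partial\Omega)$ is identified with a real number. Suprema of $L^\infty$ functions are essential suprema. $\partial_\nu=-\partial_r$ on all of $\overline\Omega$. The problem is $$\varepsilon\partial_tu_\varepsilon-\Delta u_\varepsilon=0\ \text{in }\Omega\times(0,\infty),\quad \partial_tu_\varepsilon+\partial_\nu u_\varepsilon=0\ \text{on }\partial\Omega\times(0,\infty),\quad u_\varepsilon(\cdot,0)=\varphi\ \text{in }\Omega,\quad u_\varepsilon(\cdot,0)=\varphi_b\ \text{on }\partial\Omega.$$ Dirichlet heat semigroup on $\Omega$ for radially symmetric $\phi$: $$[S_1(t)\phi](r)=\frac{1}{r\sqrt{4\pi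 t}}\int_1^\infty\Big(e^{-\frac{(r-\rho)^2}{4t}}-e^{-\frac{(r+\rho-2)^2}{4t}}\Big)\rho\,\phi(\rho)\,d\rho,\qquad r>1,\ t>0.$$ For $\psi\in\mathbb{R}$, $[S_2(t)\psi](r)=\dfrac{\psi}{re^t}$, $r\ge1$, $t\ge0$. Solution: put $\Phi=\varphi-S_2(0)\varphi_b$. A pair $(v_\varepsilon,w_\varepsilon)$ with $v_\varepsilon,\partial_\nu v_\varepsilon,w_\varepsilon\in C(\overline\Omega\times(0,\infty))$ is a global-in-time solution if for $x\in\Omega$, $t>0$ $$w_\varepsilon(x,t)=[S_2(t)\varphi_b](x)-\int_0^t[S_2(t-s)\,\partial_\nu v_\varepsilon|_{\partial\Omega}(\cdot,s)](x)\,ds,$$ $$v_\varepsilon(x,t)=[S_1(t/\varepsilon)\Phi](x)-\int_0^t[S_1((t-s)/\varepsilon)\,\partial_tw_\varepsilon(\cdot,s)](x)\,ds,$$ where $\partial_tw_\varepsilon=F_1[\varphi_b]+F_2[v_\varepsilon]$ with $F_1[\varphi_b](x,t)=\partial_t[S_2(t)\varphi_b](x)$ and $$F_2[v](x,t)=-[S_2(0)\,\partial_\nu v|_{\partial\Omega}(\cdot,t)](x)-\int_0^t\partial_t[S_2(t-s)\,\partial_\nu v|_{\partial\Omega}(\cdot,s)](x)\,ds.$$ For every $\varepsilon\in(0,1/\sqrt{\pi})$ there is a unique radially symmetric global-in-time solution with $\sup_{0<t<T}\big(\|v_\varepsilon(\cdot,t)\|_{L^\infty(\Omega)}+\sqrt{t/\varepsilon}\,\|\partial_\nu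 v_\varepsilon(\cdot,t)\|_{L^\infty(\Omega)}+\|w_\varepsilon(\cdot,t)\|_{L^\infty(\Omega)}\big)<\infty$ for every $T>0$; $u_\varepsilon:=v_\varepsilon+w_\varepsilon$ is built from it. *)

theory Defs
  imports "HOL-Analysis.Analysis" "HOL-Probability.Essential_Supremum"
begin

text \<open>
  A radially symmetric function on the exterior domain is represented by its profile
  \<open>f :: real \<Rightarrow> real\<close>, i.e. it is the function \<open>\<lambda>x. f (norm x)\<close> on \<open>Omega\<close>; only the values of
  \<open>f\<close> on \<open>{1..}\<close> matter. Functions of space and time are curried, radius first.
\<close>

definition Omega :: "(real ^ 3) set" where
  "Omega = UNIV - ball 0 1"

text \<open>
  Extended-real valued; it is \<open>\<infinity>\<close> if the function is essentially unbounded
  (or if its absolute value is not measurable).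
\<close>

definition Linf_norm :: "(real \<Rightarrow> real) \<Rightarrow> ereal" where
  "Linf_norm f = esssup (lebesgue_on Omega) (\<lambda>x. ereal \<bar>f (norm x)\<bar>)"

definition in_Linf :: "(real \<Rightarrow> real) \<Rightarrow> bool" where
  "in_Linf f \<longleftrightarrow> (\<lambda>x. f (norm x)) \<in> borel_measurable (lebesgue_on Omega) \<and> Linf_norm f < \<infinity>"

definition continuous_radial :: "(real \<Rightarrow> real \<Rightarrow> real) \<Rightarrow> bool" where
  "continuous_radial f \<longleftrightarrow>
     continuous_on (closure Omega \<times> {0<..}) (\<lambda>(x, t). f (norm x) t)"

text \<open>The radial derivative is one-sided on the boundary sphere \<open>r = 1\<close>.\<close>

definition dnu :: "(real \<Rightarrow> real \<Rightarrow> real) \<Rightarrow> real \<Rightarrow> real \<Rightarrow> real" where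
  "dnu v r t = - vector_derivative (\<lambda>\<rho>. v \<rho> t) (at r within {1..})"

definition S1 :: "real \<Rightarrow> (real \<Rightarrow> real) \<Rightarrow> real \<Rightarrow> real" where
  "S1 t \<phi> r = 1 / (r * sqrt (4 * pi * t)) *
     (LINT \<rho>:{1<..}|lebesgue.
        (exp (- (r - \<rho>)\<^sup>2 / (4 * t)) - exp (- (r + \<rho> - 2)\<^sup>2 / (4 * t))) * \<rho> * \<phi> \<rho>)"

definition S2 :: "real \<Rightarrow> real \<Rightarrow> real \<Rightarrow> real" where
  "S2 t \<psi> r = \<psi> / (r * exp t)"

definition F1 :: "real \<Rightarrow> real \<Rightarrow> real \<Rightarrow> real" where
  "F1 \<phi>b r t = deriv (\<lambda>\<tau>. S2 \<tau> \<phi>b r) t"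

definition F2 :: "(real \<Rightarrow> real \<Rightarrow> real) \<Rightarrow> real \<Rightarrow> real \<Rightarrow> real" where
  "F2 v r t = - S2 0 (dnu v 1 t) r
     - (LINT s:{0<..<t}|lebesgue. deriv (\<lambda>\<tau>. S2 (\<tau> - s) (dnu v 1 s) r) t)"

definition dtw :: "real \<Rightarrow> (real \<Rightarrow> real \<Rightarrow> real) \<Rightarrow> real \<Rightarrow> real \<Rightarrow> real" where
  "dtw \<phi>b v r t = F1 \<phi>b r t + F2 v r t"

text \<open>
  Since Lebesgue integrals of non-integrable functions are \<open>0\<close> by convention, the convergence of
  the time integrals in the integral equations is required explicitly; given the other
  conditions and \<open>locally_bounded_solution\<close> below it holds automatically. The equations are imposed
  for \<open>r > 1\<close>; they extend to \<open>r = 1\<close> by continuity.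
\<close>

definition global_solution ::
  "real \<Rightarrow> (real \<Rightarrow> real) \<Rightarrow> real \<Rightarrow> (real \<Rightarrow> real \<Rightarrow> real) \<Rightarrow> (real \<Rightarrow> real \<Rightarrow> real) \<Rightarrow> bool"
  where
  "global_solution \<epsilon> \<phi> \<phi>b v w \<longleftrightarrow>
     continuous_radial v \<and> continuous_radial w \<and>
     (\<forall>r\<ge>1. \<forall>t>0. (\<lambda>\<rho>. v \<rho> t) differentiable (at r within {1..})) \<and>
     continuous_radial (dnu v) \<and>
     (\<forall>r>1. \<forall>t>0.
        set_integrable lebesgue {0<..<t} (\<lambda>s. S2 (t - s) (dnu v 1 s) r) \<and>
        w r t = S2 t \<phi>b r - (LINT s:{0<..<t}|lebesgue. S2 (t - s) (dnu v 1 s) r)) \<and>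
     (\<forall>r>1. \<forall>t>0.
        set_integrable lebesgue {0<..<t} (\<lambda>s. S1 ((t - s) / \<epsilon>) (\<lambda>\<rho>. dtw \<phi>b v \<rho> s) r) \<and>
        v r t = S1 (t / \<epsilon>) (\<lambda>\<rho>. \<phi> \<rho> - S2 0 \<phi>b \<rho>) r
          - (LINT s:{0<..<t}|lebesgue. S1 ((t - s) / \<epsilon>) (\<lambda>\<rho>. dtw \<phi>b v \<rho> s) r))"

definition locally_bounded_solution ::
  "real \<Rightarrow> (real \<Rightarrow> real \<Rightarrow> real) \<Rightarrow> (real \<Rightarrow> real \<Rightarrow> real) \<Rightarrow> bool"
  where
  "locally_bounded_solution \<epsilon> v w \<longleftrightarrow>
     (\<forall>T>0. (SUP t\<in>{0<..<T}.
        Linf_norm (\<lambda>r. v r t) + ereal (sqrt (t / \<epsilon>)) * Linf_norm (\<lambda>r. dnu v r t)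
          + Linf_norm (\<lambda>r. w r t)) < \<infinity>)"

end

theory Submission
  imports Defs "HOL-Probability.Distributions"
begin

text \<open>
  Everything reduces to the boundary flux \<open>g(t) = \<partial>\<^sub>\<nu>v(1,t)\<close>. The source \<open>\<partial>\<^sub>tw\<close> in the Duhamel formula
  has the form \<open>h(t)/r\<close> with \<open>\<bar>h(t)\<bar> \<le> \<bar>\<phi>\<^sub>b\<bar> + \<bar>g(t)\<bar> + \<integral>\<^sub>0\<^sup>t \<bar>g\<bar>\<close>, and if \<open>\<bar>\<rho> \<phi>(\<rho>)\<bar> \<le> M\<close> then
  \<open>\<bar>S\<^sub>1(t)\<phi>(r)\<bar> \<le> M\<close> and \<open>\<bar>S\<^sub>1(t)\<phi>(r)\<bar> \<le> M (r - 1) / (r \<surd>(\<pi>t))\<close>. The second bound is linear in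
  \<open>r - 1\<close>, so dividing the Duhamel formula by \<open>r - 1\<close> and letting \<open>r \<rightarrow> 1\<close> yields
  \<open>\<bar>g(t)\<bar> \<le> \<surd>(\<epsilon>/\<pi>) (M/\<surd>t + \<integral>\<^sub>0\<^sup>t \<bar>h(s)\<bar>/\<surd>(t - s) ds)\<close>. Integrating against \<open>exp (- \<mu> t)\<close> with \<open>\<mu>\<close>
  large and applying Tonelli gives \<open>\<integral>\<^sub>0\<^sup>T \<bar>g\<bar> \<le> C \<surd>\<epsilon>\<close>. Finally \<open>u - S\<^sub>2(t)\<phi>\<^sub>b\<close> is \<open>v\<close> minus a
  time integral of \<open>g\<close>. In \<open>v\<close> the parts coming from the data are \<open>O(\<surd>\<epsilon>)\<close> by the second bound, the
  part coming from \<open>g\<close> by the first.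
\<close>

section \<open>Bounds for the Dirichlet heat semigroup\<close>

text \<open>With variance \<open>2 * t\<close> both exponentials are unnormalized normal densities,
  centred at \<open>r\<close> and at the mirror image \<open>2 - r\<close>. Since \<open>(r + \<rho>
  - 2)\<^sup>2 - (r - \<rho>)\<^sup>2 = 4 * (r - 1) * (\<rho> - 1)\<close>, the direct term
  dominates; dropping the image leaves at most the mass of one full Gaussian.\<close>

lemma dirichlet_heat_kernel:
  fixes r t :: real
  defines "K \<equiv> (\<lambda>\<rho>. exp (- (r - \<rho>)\<^sup>2 / (4 * t)) - exp (- (r + \<rho> - 2)\<^sup>2 / (4 * t)))"
  assumes "t > 0" "r \<ge> 1"
  shows "\<And>\<rho>. \<rho> > 1 \<Longrightarrow> K \<rho> \<ge> 0"
    and "set_integrable lebesgue {1<..} K"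
    and "(LINT \<rho>:{1<..}|lebesgue. K \<rho>) \<le> sqrt (4 * pi * t)"
    and "(LINT \<rho>:{1<..}|lebesgue. K \<rho>) \<le> 2 * (r - 1)"
proof -
  define \<sigma> where "\<sigma> = sqrt (2 * t)"
  define d where "d = sqrt (4 * pi * t)"
  define n where "n \<equiv> normal_density r \<sigma>"
  define n' where "n' \<equiv> normal_density (2 - r) \<sigma>"
  have \<sigma>: "\<sigma> > 0" "\<sigma>\<^sup>2 = 2 * t" and d: "d > 0" "sqrt (2 * pi * \<sigma>\<^sup>2) = d"
    using assms by (auto simp: \<sigma>_def d_def algebra_simps)
  have n: "n \<rho> = exp (- (r - \<rho>)\<^sup>2 / (4 * t)) / d" for \<rho>
    unfolding n_def normal_density_def d using \<sigma> by (simp add: power2_commute)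
  have n': "n' \<rho> = exp (- (r + \<rho> - 2)\<^sup>2 / (4 * t)) / d" for \<rho>
    unfolding n'_def normal_density_def d using \<sigma> by (simp add: algebra_simps)
  have K: "K \<rho> = d * (n \<rho> - n' \<rho>)" for \<rho>
    using d by (simp add: K_def n n' field_simps)
  show "K \<rho> \<ge> 0" if "\<rho> > 1" for \<rho>
  proof -
    have "(r - 1) * (\<rho> - 1) \<ge> 0" using that assms by simp
    then have "(r - \<rho>)\<^sup>2 \<le> (r + \<rho> - 2)\<^sup>2"
      by (simp add: power2_eq_square algebra_simps)
    then show ?thesis using assms by (simp add: K_def divide_right_mono)
  qed
  have i[simp, intro]: "integrable lborel n" "integrable lborel n'"
    using integrable_normal_density \<sigma> by (auto simp: n_def n'_def)
  have nn: "n \<rho> \<ge> 0" "n' \<rho> \<ge> 0" "n \<rho> \<le> 1 / d" for \<rho>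
    using d assms by (auto simp: n n' divide_right_mono)
  have si[intro]: "set_integrable lborel A n" "set_integrable lborel A n'" if "A \<in> sets borel" for A
    using that unfolding set_integrable_def by (auto intro!: integrable_mult_indicator simp del: real_scaleR_def)
  have iK: "set_integrable lborel {1<..} K"
    unfolding K by (intro set_integrable_mult_right set_integral_diff si) auto
  show "set_integrable lebesgue {1<..} K"
    using iK unfolding set_integrable_def by (intro integrable_completion[THEN iffD2]) auto
  have eq: "(LINT \<rho>:{1<..}|lebesgue. K \<rho>) = (LINT \<rho>:{1<..}|lborel. K \<rho>)"
    using iK unfolding set_lebesgue_integral_def set_integrable_def
    by (intro integral_completion) auto
  also have "\<dots> = d * ((LINT \<rho>:{1<..}|lborel. n \<rho>) - (LINT \<rho>:{1<..}|lborel. n' \<rho>))"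
    unfolding K by (subst set_integral_mult_right, subst set_integral_diff) (auto simp: si)
  finally have *: "(LINT \<rho>:{1<..}|lebesgue. K \<rho>) = \<dots>" .
  have "(LINT \<rho>:{1<..}|lborel. n \<rho>) \<le> (LINT \<rho>|lborel. n \<rho>)"
    unfolding set_lebesgue_integral_def
    by (intro integral_mono integrable_mult_indicator) (auto simp: indicator_def nn)
  also have "\<dots> = 1" using \<sigma> by (simp add: n_def)
  finally have n1: "(LINT \<rho>:{1<..}|lborel. n \<rho>) \<le> 1" .
  have n2: "(LINT \<rho>:{1<..}|lborel. n' \<rho>) \<ge> 0"
    unfolding set_lebesgue_integral_def by (intro Bochner_Integration.integral_nonneg) (auto simp: nn)
  show "(LINT \<rho>:{1<..}|lebesgue. K \<rho>) \<le> sqrt (4 * pi * t)"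
    unfolding * using n1 n2 d by (fold d_def) simp
  \<comment> \<open>The image kernel is the Gaussian shifted by \<open>2 * (r - 1)\<close>, so only a strip of that width survives.\<close>
  have "(LINT \<rho>:{2*r-1<..}|lborel. n \<rho>) = (LINT \<rho>:{1<..}|lborel. n' \<rho>)"
    unfolding set_lebesgue_integral_def
    by (subst lborel_integral_real_affine[where c = 1 and t = "2 * (r - 1)"])
       (auto intro!: Bochner_Integration.integral_cong simp: indicator_def n n' power2_commute algebra_simps)
  moreover have "(LINT \<rho>:{1<..}|lborel. n \<rho>) =
      (LINT \<rho>:{1<..2*r-1}|lborel. n \<rho>) + (LINT \<rho>:{2*r-1<..}|lborel. n \<rho>)"
    using assms by (subst set_integral_Un[symmetric]) (auto simp: si ivl_disj_un intro!: arg_cong2[where f = "\<lambda>A. set_lebesgue_integral lborel A"])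
  moreover have "(LINT \<rho>:{1<..2*r-1}|lborel. n \<rho>) \<le> (LINT \<rho>:{1<..2*r-1}|lborel. 1 / d)"
    using assms by (intro set_integral_mono si) (auto simp: nn set_integrable_def)
  moreover have "\<dots> = 2 * (r - 1) / d"
    using assms by (simp add: set_lebesgue_integral_def)
  ultimately show "(LINT \<rho>:{1<..}|lebesgue. K \<rho>) \<le> 2 * (r - 1)"
    unfolding * using d by (simp add: field_simps)
qed

text \<open>If \<open>F\<close> is not integrable, its integral is \<open>0\<close> by convention
  while \<open>G\<close> is nonnegative almost everywhere, so domination alone suffices. This spares
  measurability proofs for the integrands estimated later.\<close>

lemma abs_integral_le_integral:
  fixes F G :: "'a \<Rightarrow> real"
  assumes G: "integrable M G" and FG: "AE x in M. \<bar>F x\<bar> \<le> G x"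
  shows "\<bar>\<integral>x. F x \<partial>M\<bar> \<le> (\<integral>x. G x \<partial>M)"
proof (cases "integrable M F")
  case True
  then have "(\<integral>x. \<bar>F x\<bar> \<partial>M) \<le> (\<integral>x. G x \<partial>M)"
    using G FG by (intro integral_mono_AE) auto
  then show ?thesis using integral_abs_bound[of M F] by linarith
next
  case False
  have "(\<integral>x. G x \<partial>M) \<ge> 0"
    using FG by (intro integral_nonneg_AE) auto
  then show ?thesis using False by (simp add: not_integrable_integral_eq)
qed

text \<open>The weight \<open>\<rho>\<close> in the integrand is absorbed by the bound on
  \<open>\<rho> * \<phi> \<rho>\<close>, leaving \<open>M\<close> times the kernel mass. In the
  second bound \<open>(r - 1) / r\<close> is at most \<open>min 1 (r - 1)\<close>: linear vanishing
  at the sphere serves the boundary derivative, the cap \<open>1\<close> the uniform estimate of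
  \<open>v\<close>.\<close>

lemma S1_bounds:
  assumes "t > 0" "r \<ge> 1" and M: "AE \<rho> in lebesgue. \<rho> > 1 \<longrightarrow> \<bar>\<rho> * \<phi> \<rho>\<bar> \<le> M" and "M \<ge> 0"
  shows "\<bar>S1 t \<phi> r\<bar> \<le> M" and "\<bar>S1 t \<phi> r\<bar> \<le> min 1 (r - 1) * (M / sqrt (pi * t))"
proof -
  define K where "K \<equiv> (\<lambda>\<rho>. exp (- (r - \<rho>)\<^sup>2 / (4 * t)) - exp (- (r + \<rho> - 2)\<^sup>2 / (4 * t)))"
  note K = dirichlet_heat_kernel[OF assms(1,2), folded K_def]
  have K1: "K \<rho> \<ge> 0" if "\<rho> > 1" for \<rho>
    using dirichlet_heat_kernel(1)[OF assms(1,2) that] by (simp add: K_def)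
  define I where "I = (LINT \<rho>:{1<..}|lebesgue. K \<rho> * \<rho> * \<phi> \<rho>)"
  have I: "\<bar>I\<bar> \<le> M * (LINT \<rho>:{1<..}|lebesgue. K \<rho>)"
  proof -
    have MK: "set_integrable lebesgue {1<..} (\<lambda>\<rho>. M * K \<rho>)"
      using K(2) by simp
    have "\<bar>I\<bar> \<le> (LINT \<rho>:{1<..}|lebesgue. M * K \<rho>)"
      unfolding I_def set_lebesgue_integral_def
    proof (rule abs_integral_le_integral)
      show "AE \<rho> in lebesgue. \<bar>indicator {1<..} \<rho> *\<^sub>R (K \<rho> * \<rho> * \<phi> \<rho>)\<bar>
          \<le> indicator {1<..} \<rho> *\<^sub>R (M * K \<rho>)"
        using M
      proof eventually_elim
        case (elim \<rho>)
        show ?case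
        proof (cases "\<rho> > 1")
          case True
          then have "\<bar>\<rho> * \<phi> \<rho>\<bar> * K \<rho> \<le> M * K \<rho>"
            using elim K1 by (intro mult_right_mono) auto
          then show ?thesis using True K1[of \<rho>] by (simp add: abs_mult ac_simps)
        qed auto
      qed
    qed (use MK in \<open>auto simp: set_integrable_def\<close>)
    then show ?thesis by simp
  qed
  have S: "\<bar>S1 t \<phi> r\<bar> = \<bar>I\<bar> / (r * sqrt (4 * pi * t))"
    using assms by (simp add: S1_def I_def K_def abs_mult)
  have "M * (LINT \<rho>:{1<..}|lebesgue. K \<rho>) \<le> M * sqrt (4 * pi * t)"
    using K \<open>M \<ge> 0\<close> by (intro mult_left_mono) auto
  also have "\<dots> \<le> M * (r * sqrt (4 * pi * t))"
    using assms by (intro mult_left_mono) auto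
  finally show "\<bar>S1 t \<phi> r\<bar> \<le> M"
    unfolding S using I assms by (simp add: field_simps)
  have q: "sqrt (4 * pi * t) = 2 * sqrt (pi * t)" by (simp add: real_sqrt_mult)
  have "M * (LINT \<rho>:{1<..}|lebesgue. K \<rho>) \<le> M * (2 * (r - 1))"
    using K \<open>M \<ge> 0\<close> by (intro mult_left_mono) auto
  also have "\<dots> \<le> M * (2 * (r * min 1 (r - 1)))"
  proof -
    have "r - 1 \<le> r * min 1 (r - 1)"
      using mult_right_mono[of 1 r "r - 1"] assms by (simp add: min_def)
    then show ?thesis using \<open>M \<ge> 0\<close> by (intro mult_left_mono) auto
  qed
  finally have "\<bar>I\<bar> \<le> M * (2 * (r * min 1 (r - 1)))"
    using I by linarith
  then have "\<bar>I\<bar> / (r * (2 * sqrt (pi * t))) \<le> M * (2 * (r * min 1 (r - 1))) / (r * (2 * sqrt (pi * t)))"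
    using assms by (intro divide_right_mono) auto
  also have "\<dots> = min 1 (r - 1) * (M / sqrt (pi * t))"
    using assms by simp
  finally show "\<bar>S1 t \<phi> r\<bar> \<le> min 1 (r - 1) * (M / sqrt (pi * t))"
    unfolding S q .
qed

section \<open>A weighted Volterra inequality with inverse-square-root kernel\<close>

text \<open>This is \<open>Gamma (1/2) = sqrt pi\<close> after scaling time by \<open>\<mu>\<close>.
  The decay in \<open>\<mu>\<close> lets a large exponential weight make the Volterra kernel
  small.\<close>

lemma nn_integral_exp_over_sqrt:
  assumes "\<mu> > 0"
  shows "(\<integral>\<^sup>+t. ennreal (indicator {0<..} t * (exp (- \<mu> * t) / sqrt t)) \<partial>lborel) = ennreal (sqrt (pi / \<mu>))"
proof -
  let ?I = "\<integral>\<^sup>+t. ennreal (indicator {0<..} t * (exp (- \<mu> * t) / sqrt t)) \<partial>lborel"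
  have "ennreal (sqrt pi) = (\<integral>\<^sup>+t. ennreal (indicator {0..} t * t powr (1/2 - 1) / exp t) \<partial>lborel)"
    using Gamma_conv_nn_integral_real[of "1/2"] by (simp add: Gamma_one_half_real)
  also have "\<dots> = ennreal \<mu> * (\<integral>\<^sup>+t. ennreal (indicator {0..} (\<mu> * t) * (\<mu> * t) powr (1/2 - 1) / exp (\<mu> * t)) \<partial>lborel)"
    using assms by (subst nn_integral_real_affine[where c = \<mu> and t = 0]) auto
  also have "(\<lambda>t. ennreal (indicator {0..} (\<mu> * t) * (\<mu> * t) powr (1/2 - 1) / exp (\<mu> * t)))
      = (\<lambda>t. ennreal (1 / sqrt \<mu>) * ennreal (indicator {0<..} t * (exp (- \<mu> * t) / sqrt t)))"
  proof (intro ext)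
    fix t :: real
    show "ennreal (indicator {0..} (\<mu> * t) * (\<mu> * t) powr (1/2 - 1) / exp (\<mu> * t))
      = ennreal (1 / sqrt \<mu>) * ennreal (indicator {0<..} t * (exp (- \<mu> * t) / sqrt t))"
    proof (cases "t > 0")
      case True
      have "(1/2 - 1 :: real) = - (1/2)" by simp
      then have "(\<mu> * t) powr (1/2 - 1) = 1 / (\<mu> * t) powr (1/2)"
        by (simp only: powr_minus_divide)
      also have "\<dots> = 1 / (sqrt \<mu> * sqrt t)"
        using True assms by (simp add: powr_half_sqrt real_sqrt_mult)
      finally have "(\<mu> * t) powr (1/2 - 1) = 1 / (sqrt \<mu> * sqrt t)" .
      with True assms show ?thesis
        by (simp add: ennreal_mult[symmetric] exp_minus field_simps)
    next
      \<comment> \<open>At \<open>t = 0\<close> the closed and the open indicator give the same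
        value because \<open>0 powr _ = 0\<close>.\<close>
      case False
      then show ?thesis
        using assms by (cases "t = 0") (auto simp: indicator_def zero_le_mult_iff)
    qed
  qed
  also have "ennreal \<mu> * (\<integral>\<^sup>+t. ennreal (1 / sqrt \<mu>) * ennreal (indicator {0<..} t * (exp (- \<mu> * t) / sqrt t)) \<partial>lborel)
      = ennreal (sqrt \<mu>) * ?I"
    using assms by (subst nn_integral_cmult) (auto simp: mult.assoc[symmetric] ennreal_mult[symmetric] real_div_sqrt)
  finally have "ennreal (sqrt pi) = ennreal (sqrt \<mu>) * ?I" .
  then have "ennreal (1 / sqrt \<mu>) * ennreal (sqrt pi) = ennreal (1 / sqrt \<mu>) * (ennreal (sqrt \<mu>) * ?I)"
    by simp
  then show ?thesis
    using assms by (simp add: mult.assoc[symmetric] ennreal_mult[symmetric] real_sqrt_divide)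
qed

text \<open>
  The inequality is only required for finite \<open>J\<close> because the singular integral may diverge at
  individual times \<open>t\<close>. The term \<open>exp (\<mu> * s) * x\<close> replaces \<open>\<integral>\<^sub>0\<^sup>s a\<close>, which it dominates.
\<close>

lemma volterra_weighted_L1_bound:
  fixes a :: "real \<Rightarrow> real"
  assumes a[measurable]: "a \<in> borel_measurable borel" and a0: "\<And>t. a t \<ge> 0"
    and pos: "T > 0" "\<mu> > 0" "k > 0" "M \<ge> 0" "c \<ge> 0" "x \<ge> 0"
    and x: "(\<integral>\<^sup>+t. ennreal (indicator {0<..<T} t * (exp (- \<mu> * t) * a t)) \<partial>lborel) = ennreal x"
    and ineq: "\<And>t J. 0 < t \<Longrightarrow> t < T \<Longrightarrow> J \<ge> 0 \<Longrightarrow>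
      (\<integral>\<^sup>+s. ennreal (indicator {0<..<t} s * ((c + a s + exp (\<mu> * s) * x) / sqrt (t - s))) \<partial>lborel) = ennreal J \<Longrightarrow>
      a t \<le> k * (M / sqrt t + J)"
    and small: "k * sqrt (pi / \<mu>) * (1 + T) \<le> 1 / 2"
  shows "x \<le> 2 * (k * sqrt (pi / \<mu>)) * (M + c * T)"
proof -
  define P where "P = sqrt (pi / \<mu>)"
  define b where "b = (\<lambda>s. c + a s + exp (\<mu> * s) * x)"
  \<comment> \<open>Since \<open>exp (- \<mu> * t) = exp (- \<mu> * s) * exp (- \<mu> * (t -
    s))\<close>, multiplying the Volterra integral by the weight turns it into the convolution of
    \<open>B\<close> with \<open>E\<close>.\<close>
  define E where "E = (\<lambda>t. indicator {0<..} t * (exp (- \<mu> * t) / sqrt t) :: real)"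
  define B where "B = (\<lambda>s. indicator {0<..<T} s * (exp (- \<mu> * s) * b s) :: real)"
  define j where "j = (\<lambda>t. \<integral>\<^sup>+s. ennreal (indicator {0<..<t} s * (b s / sqrt (t - s))) \<partial>lborel)"
  have [measurable]: "b \<in> borel_measurable borel" "E \<in> borel_measurable borel" "B \<in> borel_measurable borel"
    unfolding b_def E_def B_def by measurable
  have b0: "b s \<ge> 0" for s using pos a0 by (simp add: b_def)
  have E0: "E s \<ge> 0" and B0: "B s \<ge> 0" for s
    using b0 by (auto simp: E_def B_def indicator_def)
  have P: "P \<ge> 0" using pos by (simp add: P_def)
  have E: "(\<integral>\<^sup>+t. ennreal (E t) \<partial>lborel) = ennreal P"
    unfolding E_def P_def by (rule nn_integral_exp_over_sqrt) fact
  have E_shift: "(\<integral>\<^sup>+t. ennreal (E (t - s)) \<partial>lborel) = ennreal P" for s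
    using nn_integral_real_affine[of "\<lambda>t. ennreal (E t)" 1 "- s"] E by simp
  have pw: "ennreal (indicator {0<..<T} t * (exp (- \<mu> * t) * a t))
      \<le> ennreal k * (ennreal M * ennreal (E t) + (\<integral>\<^sup>+s. ennreal (B s) * ennreal (E (t - s)) \<partial>lborel))" for t
  proof (cases "0 < t \<and> t < T")
    case True
    have "ennreal (a t) \<le> ennreal k * (ennreal (M / sqrt t) + j t)"
    proof (cases "j t")
      case (real J)
      then show ?thesis
        using ineq[of t J] True pos
        by (simp add: j_def b_def ennreal_plus[symmetric] ennreal_mult[symmetric] ennreal_leI del: ennreal_plus)
    next
      \<comment> \<open>\<open>ineq\<close> says nothing here, but \<open>k > 0\<close> makes the
        right-hand side infinite.\<close>
      case top
      then show ?thesis using pos by (simp add: ennreal_mult_top)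
    qed
    then have "ennreal (exp (- \<mu> * t)) * ennreal (a t)
        \<le> ennreal (exp (- \<mu> * t)) * (ennreal k * (ennreal (M / sqrt t) + j t))"
      by (rule mult_left_mono) simp
    also have "\<dots> = ennreal k * (ennreal (exp (- \<mu> * t)) * ennreal (M / sqrt t) + ennreal (exp (- \<mu> * t)) * j t)"
      by (simp add: algebra_simps)
    also have "ennreal (exp (- \<mu> * t)) * ennreal (M / sqrt t) = ennreal M * ennreal (E t)"
      using True pos by (simp add: E_def ennreal_mult[symmetric])
    also have "ennreal (exp (- \<mu> * t)) * j t
        = (\<integral>\<^sup>+s. ennreal (exp (- \<mu> * t)) * ennreal (indicator {0<..<t} s * (b s / sqrt (t - s))) \<partial>lborel)"
      unfolding j_def by (rule nn_integral_cmult[symmetric]) measurable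
    also have "\<dots> = (\<integral>\<^sup>+s. ennreal (B s) * ennreal (E (t - s)) \<partial>lborel)"
    proof (rule nn_integral_cong)
      fix s
      show "ennreal (exp (- \<mu> * t)) * ennreal (indicator {0<..<t} s * (b s / sqrt (t - s)))
          = ennreal (B s) * ennreal (E (t - s))"
        using True b0[of s]
        by (auto simp: B_def E_def ennreal_mult[symmetric] indicator_def exp_diff exp_minus right_diff_distrib field_simps)
    qed
    finally show ?thesis using True a0[of t] by (simp add: ennreal_mult[symmetric])
  qed auto
  have Fub: "(\<integral>\<^sup>+t. (\<integral>\<^sup>+s. ennreal (B s) * ennreal (E (t - s)) \<partial>lborel) \<partial>lborel) = ennreal P * (\<integral>\<^sup>+s. ennreal (B s) \<partial>lborel)"
  proof -
    have "(\<integral>\<^sup>+t. (\<integral>\<^sup>+s. ennreal (B s) * ennreal (E (t - s)) \<partial>lborel) \<partial>lborel)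
        = (\<integral>\<^sup>+s. (\<integral>\<^sup>+t. ennreal (B s) * ennreal (E (t - s)) \<partial>lborel) \<partial>lborel)"
      by (rule lborel_pair.Fubini') measurable
    also have "\<dots> = (\<integral>\<^sup>+s. ennreal (B s) * ennreal P \<partial>lborel)"
      by (subst nn_integral_cmult) (auto simp: E_shift)
    also have "\<dots> = ennreal P * (\<integral>\<^sup>+s. ennreal (B s) \<partial>lborel)"
      by (subst nn_integral_multc) (auto simp: mult.commute)
    finally show ?thesis .
  qed
  \<comment> \<open>The weight cancels \<open>exp (\<mu> * s)\<close> in front of \<open>x\<close>,
    so the three parts of \<open>b\<close> contribute at most \<open>c * T\<close>, \<open>x\<close>
    and \<open>x * T\<close>.\<close>
  have "(\<integral>\<^sup>+s. ennreal (B s) \<partial>lborel)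
      \<le> (\<integral>\<^sup>+s. ennreal (c + x) * indicator {0<..<T} s + ennreal (indicator {0<..<T} s * (exp (- \<mu> * s) * a s)) \<partial>lborel)"
  proof (rule nn_integral_mono)
    fix s
    have "B s \<le> (c + x) + exp (- \<mu> * s) * a s" if "0 < s" "s < T"
    proof -
      have "exp (- \<mu> * s) * c \<le> c" using that pos by (intro mult_left_le_one_le) auto
      moreover have "exp (- \<mu> * s) * (exp (\<mu> * s) * x) = x" by (simp add: exp_minus)
      moreover have "B s = exp (- \<mu> * s) * c + exp (- \<mu> * s) * a s + exp (- \<mu> * s) * (exp (\<mu> * s) * x)"
        using that by (simp add: B_def b_def distrib_left)
      ultimately show ?thesis by linarith
    qed
    then show "ennreal (B s) \<le> ennreal (c + x) * indicator {0<..<T} s + ennreal (indicator {0<..<T} s * (exp (- \<mu> * s) * a s))"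
      using pos a0 by (auto simp: indicator_def B_def ennreal_plus[symmetric] ennreal_leI simp del: ennreal_plus)
  qed
  also have "\<dots> = ennreal (c + x) * ennreal T + ennreal x"
    using pos x by (subst nn_integral_add) (auto simp: nn_integral_cmult simp del: ennreal_plus)
  also have "\<dots> = ennreal ((c + x) * T + x)"
    using pos by (simp add: ennreal_plus[symmetric] ennreal_mult[symmetric] del: ennreal_plus)
  finally have B: "(\<integral>\<^sup>+s. ennreal (B s) \<partial>lborel) \<le> ennreal ((c + x) * T + x)" .
  have "ennreal x \<le> (\<integral>\<^sup>+t. ennreal k * (ennreal M * ennreal (E t) + (\<integral>\<^sup>+s. ennreal (B s) * ennreal (E (t - s)) \<partial>lborel)) \<partial>lborel)"
    unfolding x[symmetric] by (intro nn_integral_mono pw)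
  also have "\<dots> = ennreal k * (ennreal M * ennreal P + ennreal P * (\<integral>\<^sup>+s. ennreal (B s) \<partial>lborel))"
    by (simp add: nn_integral_cmult nn_integral_add E Fub)
  also have "\<dots> \<le> ennreal k * (ennreal M * ennreal P + ennreal P * ennreal ((c + x) * T + x))"
    by (intro mult_left_mono add_left_mono B) auto
  also have "\<dots> = ennreal (k * (M * P + P * ((c + x) * T + x)))"
    using pos P by (simp add: ennreal_plus[symmetric] ennreal_mult[symmetric] del: ennreal_plus)
  finally have "x \<le> k * (M * P + P * ((c + x) * T + x))"
    using pos P by (subst (asm) ennreal_le_iff) auto
  also have "\<dots> = k * P * (M + c * T) + (k * P * (1 + T)) * x"
    by (simp add: algebra_simps)
  \<comment> \<open>As \<open>x\<close> is a real number, half of it can be absorbed on the left;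
    hence the factor \<open>2\<close> in the claim.\<close>
  also have "(k * P * (1 + T)) * x \<le> 1 / 2 * x"
    using small pos unfolding P_def by (intro mult_right_mono) auto
  finally show ?thesis by (simp add: P_def)
qed

section \<open>Boundary derivatives, radial continuity and the shape of the source\<close>

text \<open>The bound says nothing at \<open>a\<close> itself, but continuity forces
  \<open>f a = 0\<close>. So \<open>f r / (r - a)\<close> is the difference quotient and its limit
  inherits the bound. This suits \<open>v\<close>, whose integral equation is imposed only for
  \<open>r > 1\<close>.\<close>

lemma vector_derivative_bound_at_left_endpoint:
  fixes f :: "real \<Rightarrow> real"
  assumes f: "f differentiable (at a within {a..})"
    and bound: "\<And>r. r > a \<Longrightarrow> \<bar>f r\<bar> \<le> L * (r - a)"
  shows "\<bar>vector_derivative f (at a within {a..})\<bar> \<le> L"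
proof -
  have at: "at a within {a..} = at_right a"
    by (rule at_within_nhd[of _ UNIV]) auto
  have "(f \<longlongrightarrow> f a) (at_right a)"
    using differentiable_imp_continuous_within[OF f] by (simp add: continuous_within at)
  moreover have "(f \<longlongrightarrow> 0) (at_right a)"
  proof (rule Lim_null_comparison)
    show "\<forall>\<^sub>F r in at_right a. norm (f r) \<le> L * (r - a)"
      using bound by (auto simp: eventually_at_filter)
    show "((\<lambda>r. L * (r - a)) \<longlongrightarrow> 0) (at_right a)"
      by (auto intro!: tendsto_eq_intros)
  qed
  ultimately have fa: "f a = 0"
    by (rule tendsto_unique[rotated]) simp
  have "(f has_vector_derivative vector_derivative f (at_right a)) (at_right a)"
    using f by (simp add: at vector_derivative_works)
  then have "((\<lambda>r. f r / (r - a)) \<longlongrightarrow> vector_derivative f (at_right a)) (at_right a)"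
    by (simp add: has_real_derivative_iff_has_vector_derivative[symmetric] has_field_derivative_iff fa)
  moreover have "\<forall>\<^sub>F r in at_right a. norm (f r / (r - a)) \<le> L"
    using bound by (auto simp: eventually_at_filter abs_divide pos_divide_le_eq)
  ultimately have "norm (vector_derivative f (at_right a)) \<le> L"
    by (intro tendsto_upperbound[OF tendsto_norm]) auto
  then show ?thesis by (simp add: at)
qed

text \<open>For \<open>0 < s < t\<close> one has \<open>1 \<le> exp t * exp (- (t - s))\<close>, so
  the Gamma integral with \<open>\<mu> = 1\<close> controls the finite interval.\<close>

lemma integral_inverse_sqrt_le:
  assumes "t > 0"
  shows "integrable lborel (\<lambda>s. indicator {0<..<t} s * (1 / sqrt (t - s)))"
    and "(\<integral>s. indicator {0<..<t} s * (1 / sqrt (t - s)) \<partial>lborel) \<le> exp t * sqrt pi"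
proof -
  let ?E = "\<lambda>t. indicator {0<..} t * (exp (- 1 * t) / sqrt t) :: real"
  let ?F = "\<lambda>s. indicator {0<..<t} s * (1 / sqrt (t - s)) :: real"
  have "(\<integral>\<^sup>+s. ennreal (?F s) \<partial>lborel) \<le> (\<integral>\<^sup>+s. ennreal (exp t) * ennreal (?E (t - s)) \<partial>lborel)"
  proof (rule nn_integral_mono)
    fix s
    have "1 / sqrt (t - s) \<le> exp s * (1 / sqrt (t - s))" if "0 < s" "s < t"
      using that mult_right_mono[of 1 "exp s" "1 / sqrt (t - s)"] by simp
    then show "ennreal (?F s) \<le> ennreal (exp t) * ennreal (?E (t - s))"
      by (auto simp: indicator_def ennreal_mult[symmetric] exp_diff exp_minus field_simps intro!: ennreal_leI)
  qed
  also have "\<dots> = ennreal (exp t) * (\<integral>\<^sup>+s. ennreal (?E (t - s)) \<partial>lborel)"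
    by (rule nn_integral_cmult) measurable
  also have "(\<integral>\<^sup>+s. ennreal (?E (t - s)) \<partial>lborel) = ennreal (sqrt (pi / 1))"
    using nn_integral_real_affine[of "\<lambda>t. ennreal (?E t)" "- 1" t] nn_integral_exp_over_sqrt[of 1]
    by simp
  finally have *: "(\<integral>\<^sup>+s. ennreal (?F s) \<partial>lborel) \<le> ennreal (exp t * sqrt pi)"
    by (simp add: ennreal_mult)
  show "integrable lborel ?F"
    using * by (intro integrableI_nonneg) (auto simp: indicator_def intro: le_less_trans)
  then show "(\<integral>s. ?F s \<partial>lborel) \<le> exp t * sqrt pi"
    using * by (subst (asm) nn_integral_eq_integral) (auto simp: indicator_def)
qed

lemma closure_Omega: "closure Omega = Omega"
  by (simp add: Omega_def closed_Diff)

lemma mem_Omega: "x \<in> Omega \<longleftrightarrow> norm x \<ge> 1"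
  by (auto simp: Omega_def)

text \<open>Restrict to the ray through the first unit vector, along which the norm is
  \<open>r\<close>.\<close>

lemma continuous_radial_imp_continuous_on:
  assumes "continuous_radial f"
  shows "continuous_on ({1..} \<times> {0<..}) (\<lambda>(r, t). f r t)"
proof -
  have "continuous_on ({1..} \<times> {0<..})
      ((\<lambda>(x, t). f (norm x) t) \<circ> (\<lambda>(r, t). (r *\<^sub>R axis 1 1 :: real ^ 3, t)))"
  proof (rule continuous_on_compose)
    show "continuous_on ({1..} \<times> {0<..}) (\<lambda>(r, t). (r *\<^sub>R axis 1 1 :: real ^ 3, t::real))"
      by (auto simp: case_prod_unfold intro!: continuous_intros)
    show "continuous_on ((\<lambda>(r, t). (r *\<^sub>R axis 1 1 :: real ^ 3, t)) ` ({1..} \<times> {0<..})) (\<lambda>(x, t). f (norm x) t)"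
      using assms unfolding continuous_radial_def closure_Omega
      by (rule continuous_on_subset) (auto simp: mem_Omega norm_axis_1)
  qed
  then show ?thesis
    by (rule continuous_on_eq) (auto simp: norm_axis_1)
qed

lemma continuous_radial_imp_continuous_on_space:
  assumes "continuous_radial f" "t > 0"
  shows "continuous_on {1..} (\<lambda>r. f r t)"
proof -
  have "continuous_on {1..} (\<lambda>r. (r, t))"
    by (intro continuous_intros)
  from continuous_on_compose2[OF continuous_radial_imp_continuous_on[OF assms(1)] this] show ?thesis
    using assms(2) by auto
qed

lemma continuous_radial_imp_continuous_on_time:
  assumes "continuous_radial f" "r \<ge> 1"
  shows "continuous_on {0<..} (\<lambda>t. f r t)"
proof -
  have "continuous_on {0<..} (\<lambda>t. (r, t))"
    by (intro continuous_intros)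
  from continuous_on_compose2[OF continuous_radial_imp_continuous_on[OF assms(1)] this] show ?thesis
    using assms(2) by auto
qed

lemma S2_altdef: "S2 t \<psi> r = \<psi> / r * exp (- t)"
  by (simp only: S2_def exp_minus divide_inverse inverse_mult_distrib mult.assoc)

lemma deriv_S2: "deriv (\<lambda>\<tau>. S2 (\<tau> - s) \<psi> r) t = - S2 (t - s) \<psi> r"
proof (rule DERIV_imp_deriv)
  have "((\<lambda>\<tau>. exp (- (\<tau> - s))) has_real_derivative - exp (- (t - s))) (at t)"
    by (auto intro!: derivative_eq_intros)
  from DERIV_cmult[OF this, of "\<psi> / r"]
  show "((\<lambda>\<tau>. S2 (\<tau> - s) \<psi> r) has_real_derivative - S2 (t - s) \<psi> r) (at t)"
    by (simp add: S2_altdef)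
qed

text \<open>Each \<open>S2\<close> is \<open>1 / r\<close> times a function of time, so
  \<open>r * dtw \<phi>b v r t\<close> does not depend on \<open>r\<close>; it is the weighted
  quantity that \<open>S1_bounds\<close> asks for.\<close>

lemma dtw_altdef:
  assumes "r > 0"
  shows "r * dtw \<phi>b v r t =
    - \<phi>b * exp (- t) - dnu v 1 t + (LINT s:{0<..<t}|lebesgue. exp (s - t) * dnu v 1 s)"
proof -
  have "F1 \<phi>b r t = - S2 t \<phi>b r"
    using deriv_S2[of 0 \<phi>b r t] by (simp add: F1_def)
  moreover have "F2 v r t = - S2 0 (dnu v 1 t) r + (LINT s:{0<..<t}|lebesgue. S2 (t - s) (dnu v 1 s) r)"
    unfolding F2_def deriv_S2 by (simp add: set_lebesgue_integral_def)
  moreover have "(LINT s:{0<..<t}|lebesgue. S2 (t - s) (dnu v 1 s) r)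
      = (LINT s:{0<..<t}|lebesgue. exp (s - t) * dnu v 1 s) / r"
    unfolding S2_altdef by (subst set_integral_divide_zero[symmetric]) (simp add: mult.commute)
  ultimately show ?thesis
    using assms by (simp add: dtw_def S2_altdef field_simps)
qed

section \<open>The boundary flux of a single solution\<close>

text \<open>\<open>T\<close> and \<open>M\<close> are fixed independently of
  \<open>\<epsilon>\<close>, so that constants built from them and \<phi>b are uniform over the
  family of solutions.\<close>

locale radial_solution =
  fixes \<epsilon> \<phi>b T M :: real and \<phi> :: "real \<Rightarrow> real" and v w :: "real \<Rightarrow> real \<Rightarrow> real"
  assumes eps: "0 < \<epsilon>" "\<epsilon> < 1"
    and T: "0 < T"
    and M: "0 \<le> M" "AE \<rho> in lebesgue. \<rho> > 1 \<longrightarrow> \<bar>\<rho> * (\<phi> \<rho> - S2 0 \<phi>b \<rho>)\<bar> \<le> M"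
    and sol: "global_solution \<epsilon> \<phi> \<phi>b v w"
begin

definition g where "g = (\<lambda>t. dnu v 1 t)"
text \<open>The cut-off at \<open>0\<close> makes \<open>a\<close> Borel measurable on the whole
  line, since \<open>g\<close> is known to be continuous only for positive times.\<close>

definition a where "a = (\<lambda>t. indicator {0<..} t * \<bar>g t\<bar> :: real)"
text \<open>The weight makes the Volterra map of the flux a contraction with factor \<open>1/2\<close> for all \<open>\<epsilon> < 1\<close>.\<close>

definition \<mu> where "\<mu> = 4 * (1 + T)\<^sup>2"
definition x where "x = (\<integral>t. indicator {0<..<T} t * (exp (- \<mu> * t) * a t) \<partial>lborel)"
text \<open>The factor that remains when \<open>1 / sqrt (pi * t)\<close> is evaluated at the
  rescaled time \<open>t / \<epsilon>\<close>.\<close>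

definition k where "k = sqrt (\<epsilon> / pi)"

lemma \<mu>_pos: "\<mu> > 0" and k_pos: "k > 0"
  using T eps by (auto simp: \<mu>_def k_def)

lemma k_mu: "k * sqrt (pi / \<mu>) = sqrt \<epsilon> / (2 * (1 + T))"
proof -
  have "k * sqrt (pi / \<mu>) = sqrt (\<epsilon> / \<mu>)"
    by (simp add: k_def real_sqrt_mult[symmetric])
  then show ?thesis using T by (simp add: \<mu>_def real_sqrt_divide real_sqrt_mult)
qed

lemma v_cont: "t > 0 \<Longrightarrow> continuous_on {1..} (\<lambda>r. v r t)"
  and w_cont: "t > 0 \<Longrightarrow> continuous_on {1..} (\<lambda>r. w r t)"
  using sol by (auto simp: global_solution_def intro: continuous_radial_imp_continuous_on_space)

lemma g_cont: "continuous_on {0<..} g"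
  unfolding g_def using sol
  by (auto simp: global_solution_def intro: continuous_radial_imp_continuous_on_time)

lemma a_measurable [measurable]: "a \<in> borel_measurable borel"
proof -
  have "(\<lambda>t. indicator {0<..} t *\<^sub>R \<bar>g t\<bar>) \<in> borel_measurable borel"
    by (intro borel_measurable_continuous_on_indicator continuous_intros g_cont) auto
  then show ?thesis by (simp add: a_def)
qed

lemma a_nonneg: "a t \<ge> 0"
  by (simp add: a_def)

lemma a_integrable: "integrable lborel (\<lambda>t. indicator {0<..<T} t * a t)"
proof -
  \<comment> \<open>Integrability of the flux down to time \<open>0\<close> comes from the equation
    for \<open>w\<close>. Any radius above \<open>1\<close> would do; at \<open>2\<close> the kernel
    is at least \<open>exp (- T) / 2\<close>, hence the factor \<open>2 * exp T\<close>.\<close>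
  have "set_integrable lebesgue {0<..<T} (\<lambda>s. S2 (T - s) (g s) 2)"
    using sol T by (auto simp: global_solution_def g_def)
  then have *: "integrable lebesgue (\<lambda>s. 2 * exp T * (indicator {0<..<T} s * S2 (T - s) (g s) 2))"
    by (simp add: set_integrable_def)
  have "integrable lebesgue (\<lambda>t. indicator {0<..<T} t * a t)"
  proof (rule Bochner_Integration.integrable_bound[OF *])
    show "(\<lambda>t. indicator {0<..<T} t * a t) \<in> borel_measurable lebesgue"
      by (intro measurable_completion) measurable
    show "AE s in lebesgue. norm (indicator {0<..<T} s * a s)
        \<le> norm (2 * exp T * (indicator {0<..<T} s * S2 (T - s) (g s) 2))"
    proof (rule AE_I2)
      fix s
      have "\<bar>g s\<bar> \<le> exp s * \<bar>g s\<bar>" if "s > 0"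
        using that mult_right_mono[of 1 "exp s" "\<bar>g s\<bar>"] by simp
      then show "norm (indicator {0<..<T} s * a s)
          \<le> norm (2 * exp T * (indicator {0<..<T} s * S2 (T - s) (g s) 2))"
        by (auto simp: indicator_def a_def S2_altdef abs_mult exp_diff mult.commute)
    qed
  qed
  then show ?thesis
    by (subst (asm) integrable_completion) auto
qed

lemma weighted_a_integrable: "integrable lborel (\<lambda>t. indicator {0<..<T} t * (exp (- \<mu> * t) * a t))"
proof (rule Bochner_Integration.integrable_bound[OF a_integrable])
  show "AE t in lborel. norm (indicator {0<..<T} t * (exp (- \<mu> * t) * a t)) \<le> norm (indicator {0<..<T} t * a t)"
    using \<mu>_pos a_nonneg by (auto simp: indicator_def abs_mult intro!: mult_left_le_one_le)
qed measurable

lemma x_nonneg: "x \<ge> 0"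
  unfolding x_def by (intro Bochner_Integration.integral_nonneg) (auto simp: a_nonneg)

lemma x_nn_integral: "(\<integral>\<^sup>+t. ennreal (indicator {0<..<T} t * (exp (- \<mu> * t) * a t)) \<partial>lborel) = ennreal x"
  unfolding x_def using a_nonneg by (intro nn_integral_eq_integral weighted_a_integrable) auto

text \<open>Removing the weight costs only \<open>exp (\<mu> * t)\<close>, as
  \<open>exp (\<mu> * (t - s)) \<ge> 1\<close> for \<open>s < t\<close>. It serves both the memory
  term of the source and the integral in \<open>w\<close>.\<close>

lemma abs_integral_weighted_g_le:
  assumes t: "0 < t" "t \<le> T" and q: "\<And>s. 0 < s \<Longrightarrow> s < t \<Longrightarrow> \<bar>q s\<bar> \<le> 1"
  shows "\<bar>LINT s:{0<..<t}|lebesgue. q s * g s\<bar> \<le> exp (\<mu> * t) * x"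
proof -
  let ?G = "\<lambda>s. exp (\<mu> * t) * (indicator {0<..<T} s * (exp (- \<mu> * s) * a s))"
  have G: "integrable lborel ?G"
    using weighted_a_integrable by simp
  have "\<bar>LINT s:{0<..<t}|lebesgue. q s * g s\<bar> \<le> (LINT s|lebesgue. ?G s)"
    unfolding set_lebesgue_integral_def
  proof (rule abs_integral_le_integral)
    show "integrable lebesgue ?G"
      using G by (subst integrable_completion) auto
    show "AE s in lebesgue. \<bar>indicator {0<..<t} s *\<^sub>R (q s * g s)\<bar> \<le> ?G s"
    proof (rule AE_I2)
      fix s
      show "\<bar>indicator {0<..<t} s *\<^sub>R (q s * g s)\<bar> \<le> ?G s"
      proof (cases "0 < s \<and> s < t")
        case True
        have "\<bar>q s\<bar> * \<bar>g s\<bar> \<le> 1 * \<bar>g s\<bar>"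
          using True q by (intro mult_right_mono) auto
        also have "\<dots> \<le> exp (\<mu> * t - \<mu> * s) * \<bar>g s\<bar>"
          using True \<mu>_pos by (intro mult_right_mono) auto
        also have "exp (\<mu> * t - \<mu> * s) = exp (\<mu> * t) * exp (- \<mu> * s)"
          by (simp flip: exp_add)
        finally show ?thesis
          using True t by (simp add: abs_mult a_def mult.assoc)
      qed (auto simp: a_nonneg indicator_def)
    qed
  qed
  also have "\<dots> = (\<integral>s. ?G s \<partial>lborel)"
    using G by (intro integral_completion) auto
  also have "\<dots> = exp (\<mu> * t) * x"
    by (simp add: x_def)
  finally show ?thesis .
qed

lemma dtw_bound:
  assumes "0 < s" "s < T" "\<rho> > 0"
  shows "\<bar>\<rho> * dtw \<phi>b v \<rho> s\<bar> \<le> \<bar>\<phi>b\<bar> + a s + exp (\<mu> * s) * x"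
proof -
  have "\<bar>\<phi>b * exp (- s)\<bar> \<le> \<bar>\<phi>b\<bar> * 1"
    unfolding abs_mult using assms by (intro mult_left_mono) auto
  moreover have "\<bar>LINT \<sigma>:{0<..<s}|lebesgue. exp (\<sigma> - s) * g \<sigma>\<bar> \<le> exp (\<mu> * s) * x"
    using assms by (intro abs_integral_weighted_g_le) auto
  moreover have "a s = \<bar>g s\<bar>" using assms by (simp add: a_def)
  ultimately show ?thesis
    unfolding dtw_altdef[OF assms(3)] g_def[symmetric] by linarith
qed

lemma S1_dtw_bounds:
  assumes "0 < s" "s < t" "t \<le> T" "r > 1"
  defines "H \<equiv> \<bar>\<phi>b\<bar> + a s + exp (\<mu> * s) * x"
  shows "\<bar>S1 ((t - s) / \<epsilon>) (\<lambda>\<rho>. dtw \<phi>b v \<rho> s) r\<bar> \<le> H"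
    and "\<bar>S1 ((t - s) / \<epsilon>) (\<lambda>\<rho>. dtw \<phi>b v \<rho> s) r\<bar> \<le> min 1 (r - 1) * (k * (H / sqrt (t - s)))"
proof -
  have H: "H \<ge> 0" by (simp add: H_def a_nonneg x_nonneg)
  have AE: "AE \<rho> in lebesgue. \<rho> > 1 \<longrightarrow> \<bar>\<rho> * dtw \<phi>b v \<rho> s\<bar> \<le> H"
    unfolding H_def using assms by (intro AE_I2 impI dtw_bound) auto
  show "\<bar>S1 ((t - s) / \<epsilon>) (\<lambda>\<rho>. dtw \<phi>b v \<rho> s) r\<bar> \<le> H"
    using assms eps by (intro S1_bounds(1) AE H) auto
  have "\<bar>S1 ((t - s) / \<epsilon>) (\<lambda>\<rho>. dtw \<phi>b v \<rho> s) r\<bar> \<le> min 1 (r - 1) * (H / sqrt (pi * ((t - s) / \<epsilon>)))"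
    using assms eps by (intro S1_bounds(2) AE H) auto
  also have "H / sqrt (pi * ((t - s) / \<epsilon>)) = k * (H / sqrt (t - s))"
    using eps by (simp add: k_def real_sqrt_mult real_sqrt_divide)
  finally show "\<bar>S1 ((t - s) / \<epsilon>) (\<lambda>\<rho>. dtw \<phi>b v \<rho> s) r\<bar> \<le> min 1 (r - 1) * (k * (H / sqrt (t - s)))" .
qed

lemma S1_initial_bound:
  assumes "0 < t" "r > 1"
  shows "\<bar>S1 (t / \<epsilon>) (\<lambda>\<rho>. \<phi> \<rho> - S2 0 \<phi>b \<rho>) r\<bar> \<le> min 1 (r - 1) * (k * (M / sqrt t))"
proof -
  have "\<bar>S1 (t / \<epsilon>) (\<lambda>\<rho>. \<phi> \<rho> - S2 0 \<phi>b \<rho>) r\<bar> \<le> min 1 (r - 1) * (M / sqrt (pi * (t / \<epsilon>)))"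
    using assms eps M by (intro S1_bounds(2)) auto
  also have "M / sqrt (pi * (t / \<epsilon>)) = k * (M / sqrt t)"
    using eps by (simp add: k_def real_sqrt_mult real_sqrt_divide)
  finally show ?thesis .
qed

lemma v_eq:
  assumes "0 < t" "r > 1"
  shows "v r t = S1 (t / \<epsilon>) (\<lambda>\<rho>. \<phi> \<rho> - S2 0 \<phi>b \<rho>) r
    - (LINT s:{0<..<t}|lebesgue. S1 ((t - s) / \<epsilon>) (\<lambda>\<rho>. dtw \<phi>b v \<rho> s) r)"
  using sol assms by (simp add: global_solution_def)

text \<open>Finite \<open>J\<close> supplies an integrable majorant for the Duhamel integrand. Both
  terms of \<open>v\<close> are then at most linear in \<open>r - 1\<close>, and the slope bounds
  the normal derivative.\<close>

lemma boundary_flux_inequality: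
  assumes t: "0 < t" "t < T" and "J \<ge> 0"
    and J: "(\<integral>\<^sup>+s. ennreal (indicator {0<..<t} s * ((\<bar>\<phi>b\<bar> + a s + exp (\<mu> * s) * x) / sqrt (t - s))) \<partial>lborel) = ennreal J"
  shows "a t \<le> k * (M / sqrt t + J)"
proof -
  let ?H = "\<lambda>s. indicator {0<..<t} s * ((\<bar>\<phi>b\<bar> + a s + exp (\<mu> * s) * x) / sqrt (t - s))"
  have H0: "?H s \<ge> 0" for s
    using a_nonneg x_nonneg by (auto simp: indicator_def)
  have H: "integrable lborel ?H"
    using J H0 by (intro integrableI_nonneg) auto
  have H_int: "(\<integral>s. ?H s \<partial>lborel) = J"
    using J H0 \<open>J \<ge> 0\<close> by (subst integral_eq_nn_integral) auto
  have v_le: "\<bar>v r t\<bar> \<le> k * (M / sqrt t + J) * (r - 1)" if "r > 1" for r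
  proof -
    let ?G = "\<lambda>s. (r - 1) * (k * ?H s)"
    have G: "integrable lborel ?G"
      by (intro integrable_mult_right H)
    have "\<bar>LINT s:{0<..<t}|lebesgue. S1 ((t - s) / \<epsilon>) (\<lambda>\<rho>. dtw \<phi>b v \<rho> s) r\<bar> \<le> (LINT s|lebesgue. ?G s)"
      unfolding set_lebesgue_integral_def
    proof (rule abs_integral_le_integral)
      show "integrable lebesgue ?G"
        using G by (subst integrable_completion) auto
      show "AE s in lebesgue. \<bar>indicator {0<..<t} s *\<^sub>R S1 ((t - s) / \<epsilon>) (\<lambda>\<rho>. dtw \<phi>b v \<rho> s) r\<bar> \<le> ?G s"
      proof (rule AE_I2)
        fix s
        show "\<bar>indicator {0<..<t} s *\<^sub>R S1 ((t - s) / \<epsilon>) (\<lambda>\<rho>. dtw \<phi>b v \<rho> s) r\<bar> \<le> ?G s"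
        proof (cases "0 < s \<and> s < t")
          case True
          then have "\<bar>S1 ((t - s) / \<epsilon>) (\<lambda>\<rho>. dtw \<phi>b v \<rho> s) r\<bar> \<le> min 1 (r - 1) * (k * ?H s)"
            using S1_dtw_bounds(2)[of s t r] t that by simp
          also have "\<dots> \<le> ?G s"
            by (intro mult_right_mono mult_nonneg_nonneg H0 less_imp_le[OF k_pos]) auto
          finally show ?thesis using True by simp
        qed (auto simp: indicator_def)
      qed
    qed
    also have "\<dots> = (\<integral>s. ?G s \<partial>lborel)"
      using G by (intro integral_completion) auto
    also have "\<dots> = (r - 1) * (k * J)"
      by (simp only: integral_mult_right_zero H_int)
    finally have 1: "\<bar>LINT s:{0<..<t}|lebesgue. S1 ((t - s) / \<epsilon>) (\<lambda>\<rho>. dtw \<phi>b v \<rho> s) r\<bar> \<le> (r - 1) * (k * J)" .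
    have "\<bar>S1 (t / \<epsilon>) (\<lambda>\<rho>. \<phi> \<rho> - S2 0 \<phi>b \<rho>) r\<bar> \<le> min 1 (r - 1) * (k * (M / sqrt t))"
      using S1_initial_bound t that by simp
    also have "\<dots> \<le> (r - 1) * (k * (M / sqrt t))"
      using k_pos M t by (intro mult_right_mono) auto
    finally have "\<bar>v r t\<bar> \<le> (r - 1) * (k * (M / sqrt t)) + (r - 1) * (k * J)"
      using 1 v_eq[OF t(1) that] by linarith
    then show ?thesis by (simp add: algebra_simps)
  qed
  have "\<bar>vector_derivative (\<lambda>r. v r t) (at 1 within {1..})\<bar> \<le> k * (M / sqrt t + J)"
    using sol t by (intro vector_derivative_bound_at_left_endpoint v_le) (auto simp: global_solution_def)
  then show ?thesis using t by (simp add: a_def g_def dnu_def)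
qed

text \<open>By \<open>k_mu\<close> the Volterra factor \<open>2 * (k * sqrt (pi / \<mu>))\<close>
  equals \<open>sqrt \<epsilon> / (1 + T)\<close>; here the flux acquires its size in
  \<epsilon>.\<close>

lemma x_bound: "x \<le> sqrt \<epsilon> * (M + \<bar>\<phi>b\<bar> * T)"
proof -
  have small: "k * sqrt (pi / \<mu>) * (1 + T) \<le> 1 / 2"
  proof -
    have "k * sqrt (pi / \<mu>) * (1 + T) = sqrt \<epsilon> / 2"
      unfolding k_mu using T by (simp add: field_simps)
    then show ?thesis using eps by simp
  qed
  have "x \<le> 2 * (k * sqrt (pi / \<mu>)) * (M + \<bar>\<phi>b\<bar> * T)"
    by (rule volterra_weighted_L1_bound[OF a_measurable a_nonneg T \<mu>_pos k_pos M(1) _ x_nonneg x_nn_integral _ small])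
      (auto intro: boundary_flux_inequality)
  also have "\<dots> \<le> sqrt \<epsilon> * (M + \<bar>\<phi>b\<bar> * T)"
  proof (rule mult_right_mono)
    have "2 * (k * sqrt (pi / \<mu>)) = sqrt \<epsilon> / (1 + T)"
      unfolding k_mu using T by (simp add: field_simps)
    also have "\<dots> \<le> sqrt \<epsilon>"
      using T eps by (simp add: divide_le_eq mult_le_cancel_left1)
    finally show "2 * (k * sqrt (pi / \<mu>)) \<le> sqrt \<epsilon>" .
  qed (use M T in auto)
  finally show ?thesis .
qed

section \<open>Pointwise bounds for the two components and their sum\<close>

lemma v_bound:
  assumes t: "0 < t" "t < T" and r: "r > 1"
  shows "\<bar>v r t\<bar> \<le> k * (M / sqrt t) + k * \<bar>\<phi>b\<bar> * (exp T * sqrt pi) + (1 + T) * (exp (\<mu> * T) * x)"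
proof -
  let ?I = "\<lambda>s. indicator {0<..<t} s * (1 / sqrt (t - s)) :: real"
  let ?A = "\<lambda>s. indicator {0<..<T} s * (exp (- \<mu> * s) * a s)"
  \<comment> \<open>The summands majorize the contributions of \<phi>b, of the flux at time
    \<open>s\<close>, and of the accumulated flux.\<close>
  let ?G = "\<lambda>s. k * \<bar>\<phi>b\<bar> * ?I s + exp (\<mu> * T) * ?A s + exp (\<mu> * T) * x * indicator {0<..<T} s"
  have i: "integrable lborel ?I" "integrable lborel ?A" "integrable lborel (indicator {0<..<T} :: real \<Rightarrow> real)"
    by (rule integral_inverse_sqrt_le(1)[OF t(1)], rule weighted_a_integrable, rule integrable_real_indicator)
      (use T in auto)
  have G: "integrable lborel ?G"
    by (intro Bochner_Integration.integrable_add integrable_mult_right i)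
  have "\<bar>LINT s:{0<..<t}|lebesgue. S1 ((t - s) / \<epsilon>) (\<lambda>\<rho>. dtw \<phi>b v \<rho> s) r\<bar> \<le> (LINT s|lebesgue. ?G s)"
    unfolding set_lebesgue_integral_def
  proof (rule abs_integral_le_integral)
    show "integrable lebesgue ?G"
      using G by (subst integrable_completion) auto
    show "AE s in lebesgue. \<bar>indicator {0<..<t} s *\<^sub>R S1 ((t - s) / \<epsilon>) (\<lambda>\<rho>. dtw \<phi>b v \<rho> s) r\<bar> \<le> ?G s"
    proof (rule AE_I2)
      fix s
      show "\<bar>indicator {0<..<t} s *\<^sub>R S1 ((t - s) / \<epsilon>) (\<lambda>\<rho>. dtw \<phi>b v \<rho> s) r\<bar> \<le> ?G s"
      proof (cases "0 < s \<and> s < t")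
        case True
        \<comment> \<open>The gain of the smoothing bound over the plain one; it is at most
          \<open>1\<close> exactly when \<open>t - s \<ge> \<epsilon> / pi\<close>.\<close>
        define q where "q = k / sqrt (t - s)"
        define e where "e = a s + exp (\<mu> * s) * x"
        have q: "q \<ge> 0" and e: "e \<ge> 0"
          using k_pos True a_nonneg x_nonneg by (auto simp: q_def e_def)
        let ?S = "\<bar>S1 ((t - s) / \<epsilon>) (\<lambda>\<rho>. dtw \<phi>b v \<rho> s) r\<bar>"
        have S: "?S \<le> \<bar>\<phi>b\<bar> + e" "?S \<le> min 1 (r - 1) * (q * (\<bar>\<phi>b\<bar> + e))"
          using S1_dtw_bounds[of s t r] True t r by (auto simp: q_def e_def add.assoc)
        have "min 1 (r - 1) * (q * (\<bar>\<phi>b\<bar> + e)) \<le> 1 * (q * (\<bar>\<phi>b\<bar> + e))"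
          using q e by (intro mult_right_mono) auto
        with S(2) have S2: "?S \<le> q * \<bar>\<phi>b\<bar> + q * e"
          by (simp add: algebra_simps)
        \<comment> \<open>Only \<open>\<phi>b\<close> needs the smoothing factor \<open>q\<close>; on \<open>e\<close>, whose integral is already \<open>O(\<surd>\<epsilon>)\<close>, it would
          produce an integral that need not converge.\<close>
        have "?S \<le> q * \<bar>\<phi>b\<bar> + e"
        proof (cases "q \<le> 1")
          case True
          then show ?thesis using S2 mult_right_mono[of q 1 e] e by simp
        next
          case False
          then show ?thesis using S(1) mult_right_mono[of 1 q "\<bar>\<phi>b\<bar>"] by simp
        qed
        moreover have "a s \<le> exp (\<mu> * T) * (exp (- \<mu> * s) * a s)"
        proof -
          have "1 * a s \<le> exp (\<mu> * T - \<mu> * s) * a s"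
            using True t \<mu>_pos a_nonneg by (intro mult_right_mono) auto
          also have "exp (\<mu> * T - \<mu> * s) = exp (\<mu> * T) * exp (- \<mu> * s)"
            by (simp flip: exp_add)
          finally show ?thesis by (simp add: mult.assoc)
        qed
        moreover have "exp (\<mu> * s) * x \<le> exp (\<mu> * T) * x"
          using True t \<mu>_pos x_nonneg by (intro mult_right_mono) auto
        ultimately have "?S \<le> q * \<bar>\<phi>b\<bar> + exp (\<mu> * T) * (exp (- \<mu> * s) * a s) + exp (\<mu> * T) * x"
          unfolding e_def by linarith
        then show ?thesis using True t by (simp add: q_def)
      next
        case False
        then show ?thesis
          using a_nonneg x_nonneg k_pos by (auto simp: indicator_def)
      qed
    qed
  qed
  also have "\<dots> = (\<integral>s. ?G s \<partial>lborel)"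
    using G by (intro integral_completion) auto
  also have "\<dots> = k * \<bar>\<phi>b\<bar> * (\<integral>s. ?I s \<partial>lborel) + exp (\<mu> * T) * x + exp (\<mu> * T) * x * T"
  proof -
    have "(\<integral>s. ?G s \<partial>lborel) = k * \<bar>\<phi>b\<bar> * (\<integral>s. ?I s \<partial>lborel) + exp (\<mu> * T) * (\<integral>s. ?A s \<partial>lborel)
        + exp (\<mu> * T) * x * (\<integral>s. indicator {0<..<T} s \<partial>lborel)"
      by (simp only: Bochner_Integration.integral_add Bochner_Integration.integrable_add
          integrable_mult_right i integral_mult_right_zero)
    moreover have "(\<integral>s. indicator {0<..<T} s \<partial>lborel) = T"
      using T by simp
    ultimately show ?thesis by (simp only: x_def)
  qed
  also have "\<dots> \<le> k * \<bar>\<phi>b\<bar> * (exp T * sqrt pi) + exp (\<mu> * T) * x + exp (\<mu> * T) * x * T"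
  proof -
    have "(\<integral>s. ?I s \<partial>lborel) \<le> exp t * sqrt pi"
      by (rule integral_inverse_sqrt_le(2)[OF t(1)])
    also have "\<dots> \<le> exp T * sqrt pi"
      using t by (intro mult_right_mono) auto
    finally show ?thesis
      using k_pos by (intro add_right_mono mult_left_mono) auto
  qed
  finally have 1: "\<bar>LINT s:{0<..<t}|lebesgue. S1 ((t - s) / \<epsilon>) (\<lambda>\<rho>. dtw \<phi>b v \<rho> s) r\<bar>
      \<le> k * \<bar>\<phi>b\<bar> * (exp T * sqrt pi) + (1 + T) * (exp (\<mu> * T) * x)"
    by (simp add: algebra_simps)
  have "\<bar>S1 (t / \<epsilon>) (\<lambda>\<rho>. \<phi> \<rho> - S2 0 \<phi>b \<rho>) r\<bar> \<le> min 1 (r - 1) * (k * (M / sqrt t))"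
    using S1_initial_bound t r by simp
  also have "\<dots> \<le> 1 * (k * (M / sqrt t))"
    using k_pos M t by (intro mult_right_mono) auto
  finally show ?thesis
    using 1 v_eq[OF t(1) r] by linarith
qed

text \<open>The kernel \<open>exp (s - t) / r\<close> is at most \<open>1\<close>, so the weighted
  mass \<open>x\<close> of the flux controls the difference.\<close>

lemma w_bound:
  assumes t: "0 < t" "t < T" and r: "r > 1"
  shows "\<bar>w r t - S2 t \<phi>b r\<bar> \<le> exp (\<mu> * T) * x"
proof -
  have "w r t - S2 t \<phi>b r = - (LINT s:{0<..<t}|lebesgue. S2 (t - s) (g s) r)"
    using sol t r by (simp add: global_solution_def g_def)
  also have "(\<lambda>s. S2 (t - s) (g s) r) = (\<lambda>s. (exp (s - t) / r) * g s)"
    by (simp add: S2_altdef mult.commute)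
  finally have "\<bar>w r t - S2 t \<phi>b r\<bar> = \<bar>LINT s:{0<..<t}|lebesgue. (exp (s - t) / r) * g s\<bar>"
    by simp
  also have "\<dots> \<le> exp (\<mu> * t) * x"
  proof (rule abs_integral_weighted_g_le)
    fix s assume "0 < s" "s < t"
    then have "exp (s - t) \<le> 1" by simp
    then have "exp (s - t) \<le> r" using r by linarith
    then show "\<bar>exp (s - t) / r\<bar> \<le> 1" using r by simp
  qed (use t in auto)
  also have "\<dots> \<le> exp (\<mu> * T) * x"
    using t \<mu>_pos x_nonneg by (intro mult_right_mono) auto
  finally show ?thesis .
qed

text \<open>The cut-off \<tau> enters only through the initial layer \<open>M / sqrt t\<close>. The
  factor \<open>2 + T\<close> adds \<open>1 + T\<close> from \<open>v\<close> and \<open>1\<close>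
  from \<open>w\<close>.\<close>

lemma deviation_bound:
  assumes t: "\<tau> \<le> t" "0 < \<tau>" "t < T" and r: "r \<ge> 1"
  shows "\<bar>v r t + w r t - S2 t \<phi>b r\<bar>
    \<le> (M / sqrt \<tau> + \<bar>\<phi>b\<bar> * (exp T * sqrt pi) + (2 + T) * (exp (\<mu> * T) * (M + \<bar>\<phi>b\<bar> * T))) * sqrt \<epsilon>"
    (is "_ \<le> ?C * sqrt \<epsilon>")
proof -
  have t0: "0 < t" using t by simp
  have interior: "\<bar>v r t + w r t - S2 t \<phi>b r\<bar> \<le> ?C * sqrt \<epsilon>" if r: "r > 1" for r
  proof -
    have "\<epsilon> / pi \<le> \<epsilon> / 1"
      using eps pi_gt3 by (intro divide_left_mono) auto
    then have k: "k \<le> sqrt \<epsilon>"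
      unfolding k_def by simp
    have "\<bar>v r t + w r t - S2 t \<phi>b r\<bar>
        \<le> k * (M / sqrt t) + k * \<bar>\<phi>b\<bar> * (exp T * sqrt pi) + (1 + T) * (exp (\<mu> * T) * x) + exp (\<mu> * T) * x"
      using v_bound[OF t0 t(3) r] w_bound[OF t0 t(3) r] by linarith
    also have "\<dots> = k * (M / sqrt t) + k * (\<bar>\<phi>b\<bar> * (exp T * sqrt pi)) + (2 + T) * (exp (\<mu> * T) * x)"
      by (simp add: algebra_simps)
    also have "\<dots> \<le> sqrt \<epsilon> * (M / sqrt \<tau>) + sqrt \<epsilon> * (\<bar>\<phi>b\<bar> * (exp T * sqrt pi))
        + (2 + T) * (exp (\<mu> * T) * (sqrt \<epsilon> * (M + \<bar>\<phi>b\<bar> * T)))"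
    proof (intro add_mono mult_mono)
      show "M / sqrt t \<le> M / sqrt \<tau>"
        using t M by (intro divide_left_mono) auto
    qed (use k k_pos M T t eps x_bound x_nonneg in auto)
    finally show ?thesis by (simp add: algebra_simps)
  qed
  \<comment> \<open>The sphere \<open>r = 1\<close> is reached by continuity, since the integral
    equations give the estimate only in the interior.\<close>
  have "continuous_on (closure {1<..}) (\<lambda>r. \<bar>v r t + w r t - S2 t \<phi>b r\<bar>)"
    unfolding S2_def using v_cont[OF t0] w_cont[OF t0] by (auto intro!: continuous_intros)
  then show ?thesis
    by (rule continuous_le_on_closure) (use r interior in auto)
qed

end

section \<open>A uniform constant and the passage to essential suprema\<close>

theorem theorem5:
  fixes \<phi> :: "real \<Rightarrow> real" and \<phi>b \<epsilon>0 \<tau>1 \<tau>2 :: real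
    and v w u :: "real \<Rightarrow> real \<Rightarrow> real \<Rightarrow> real"
  assumes "in_Linf \<phi>"
    and "esssup (lebesgue_on {1..}) (\<lambda>\<rho>. ereal \<bar>\<rho> * \<phi> \<rho>\<bar>) < \<infinity>"
    and "0 < \<epsilon>0" and "\<epsilon>0 < 1 / sqrt pi"
    and "0 < \<tau>1" and "\<tau>1 < \<tau>2"
    and "\<And>\<epsilon>. 0 < \<epsilon> \<Longrightarrow> \<epsilon> < \<epsilon>0 \<Longrightarrow> global_solution \<epsilon> \<phi> \<phi>b (v \<epsilon>) (w \<epsilon>)"
    and "\<And>\<epsilon>. 0 < \<epsilon> \<Longrightarrow> \<epsilon> < \<epsilon>0 \<Longrightarrow> locally_bounded_solution \<epsilon> (v \<epsilon>) (w \<epsilon>)"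
    and "\<And>\<epsilon> r t. 0 < \<epsilon> \<Longrightarrow> \<epsilon> < \<epsilon>0 \<Longrightarrow> 1 \<le> r \<Longrightarrow> 0 < t \<Longrightarrow> u \<epsilon> r t = v \<epsilon> r t + w \<epsilon> r t"
  shows "\<exists>C>0. \<forall>\<epsilon>. 0 < \<epsilon> \<and> \<epsilon> < \<epsilon>0 \<longrightarrow>
    (SUP t\<in>{\<tau>1<..<\<tau>2}. Linf_norm (\<lambda>r. u \<epsilon> r t - S2 t \<phi>b r)) \<le> ereal (C * sqrt \<epsilon>)"
proof -
  note sol = assms(7) and u = assms(9)
  obtain n :: nat where n: "esssup (lebesgue_on {1..}) (\<lambda>\<rho>. ereal \<bar>\<rho> * \<phi> \<rho>\<bar>) < ereal (real n)"
    using assms(2) less_PInf_Ex_of_nat by auto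
  \<comment> \<open>\<open>\<rho> * S2 0 \<phi>b \<rho> = \<phi>b\<close>, so subtracting the
    boundary lift raises the weighted bound by at most \<open>\<bar>\<phi>b\<bar>\<close>.\<close>
  define M where "M = real n + \<bar>\<phi>b\<bar>"
  have "AE \<rho> in lebesgue_on {1..}. ereal \<bar>\<rho> * \<phi> \<rho>\<bar> \<le> esssup (lebesgue_on {1..}) (\<lambda>\<rho>. ereal \<bar>\<rho> * \<phi> \<rho>\<bar>)"
    by (rule esssup_AE)
  then have "AE \<rho> in lebesgue_on {1..}. ereal \<bar>\<rho> * \<phi> \<rho>\<bar> \<le> ereal (real n)"
  proof eventually_elim
    case (elim \<rho>)
    from order.trans[OF elim less_imp_le[OF n]] show ?case by simp
  qed
  then have "AE \<rho> in lebesgue. \<rho> \<ge> 1 \<longrightarrow> \<bar>\<rho> * \<phi> \<rho>\<bar> \<le> real n"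
    by (subst (asm) AE_restrict_space_iff) auto
  then have M: "AE \<rho> in lebesgue. \<rho> > 1 \<longrightarrow> \<bar>\<rho> * (\<phi> \<rho> - S2 0 \<phi>b \<rho>)\<bar> \<le> M"
    by eventually_elim (auto simp: M_def S2_def right_diff_distrib)
  have \<epsilon>0: "\<epsilon>0 < 1"
  proof -
    have "1 / sqrt pi \<le> 1" using pi_gt3 by simp
    then show ?thesis using assms(4) by linarith
  qed
  define C where "C = M / sqrt \<tau>1 + \<bar>\<phi>b\<bar> * (exp \<tau>2 * sqrt pi)
    + (2 + \<tau>2) * (exp (4 * (1 + \<tau>2)\<^sup>2 * \<tau>2) * (M + \<bar>\<phi>b\<bar> * \<tau>2))"
  have "C \<ge> 0" using assms(5,6) by (simp add: C_def M_def)
  show ?thesis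
  \<comment> \<open>Only \<open>C \<ge> 0\<close> has been shown; adding \<open>1\<close> makes the
    constant strictly positive.\<close>
  proof (intro exI[of _ "C + 1"] conjI allI impI SUP_least)
    fix \<epsilon> t assume \<epsilon>: "0 < \<epsilon> \<and> \<epsilon> < \<epsilon>0" and t: "t \<in> {\<tau>1<..<\<tau>2}"
    have t0: "t > 0" using t assms(5) by simp
    interpret radial_solution \<epsilon> \<phi>b \<tau>2 M \<phi> "v \<epsilon>" "w \<epsilon>"
      using \<epsilon> \<epsilon>0 assms(5,6) M sol by unfold_locales (auto simp: M_def)
    have bound: "\<bar>u \<epsilon> r t - S2 t \<phi>b r\<bar> \<le> (C + 1) * sqrt \<epsilon>" if "r \<ge> 1" for r
    proof -
      have "\<bar>u \<epsilon> r t - S2 t \<phi>b r\<bar> \<le> C * sqrt \<epsilon>"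
        using deviation_bound[of \<tau>1 t r] that t t0 \<epsilon> assms(5) u[of \<epsilon> r t] by (simp add: C_def \<mu>_def)
      also have "\<dots> \<le> (C + 1) * sqrt \<epsilon>" using \<epsilon> by simp
      finally show ?thesis .
    qed
    \<comment> \<open>A pointwise bound alone is not enough: the essential supremum of a
      nonmeasurable function is infinite by convention. Continuity gives measurability.\<close>
    have "continuous_on {1..} (\<lambda>r. v \<epsilon> r t + w \<epsilon> r t - S2 t \<phi>b r)"
      unfolding S2_def using v_cont[OF t0] w_cont[OF t0] by (auto intro!: continuous_intros)
    then have "continuous_on {1..} (\<lambda>r. u \<epsilon> r t - S2 t \<phi>b r)"
      by (rule continuous_on_eq) (use u \<epsilon> t0 in auto)
    then have "continuous_on Omega (\<lambda>y. \<bar>u \<epsilon> (norm y) t - S2 t \<phi>b (norm y)\<bar>)"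
      by (intro continuous_on_rabs continuous_on_compose2[of "{1..}" "\<lambda>r. u \<epsilon> r t - S2 t \<phi>b r" _ norm])
        (auto simp: mem_Omega intro!: continuous_intros)
    moreover have "Omega \<in> sets lebesgue"
      by (simp add: Omega_def)
    ultimately have "(\<lambda>y. \<bar>u \<epsilon> (norm y) t - S2 t \<phi>b (norm y)\<bar>) \<in> borel_measurable (lebesgue_on Omega)"
      by (rule continuous_imp_measurable_on_sets_lebesgue)
    then show "Linf_norm (\<lambda>r. u \<epsilon> r t - S2 t \<phi>b r) \<le> ereal ((C + 1) * sqrt \<epsilon>)"
      unfolding Linf_norm_def
      by (intro esssup_I AE_I2) (auto simp: mem_Omega bound)
  qed (use \<open>C \<ge> 0\<close> in simp)
qed

end
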